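(* Let $\mathfrak g$ be a finite-dimensional complex reductive Lie algebra, $\mathfrak t\subset\mathfrak g$ a Cartan subalgebra and $\Phi_{\mathfrak g}=\Phi(\mathfrak g,\mathfrak t)\subset\mathfrak t^\vee$ its root system. Let $Q=\sum_{i=1}^p A_ix^i$ with $p\ge 1$, $A_i\in\mathfrak t$, and for $\alpha\in\Phi_{\mathfrak g}$ let $d_\alpha=\deg_x\bigl(\sum_{i=1}^p\alpha(A_i)x^i\bigr)\in\{0,\dots,p\}$ (with $\deg_x(0)=0$). Let $$\mathbf B_Q=\Bigl\{(A_1',\dots,A_p')\in\mathfrak t^p : \deg_x\Bigl(\sum_{i=1}^p\alpha(A_i')x^i\Bigr)=d_\alpha\ \text{for all }\alpha\in\Phi_{\mathfrak g}\Bigr\}\subset\mathfrak t^p.$$ Then $\mathbf B_Q=\prod_{i=1}^p\mathbf B_i\subset\mathfrak t^p$, where $$\mathbf B_i=\bigcap_{\alpha:\ d_\alpha<i}\operatorname{Ker}(\alpha)\ \cap\ \bigcap_{\alpha:\ d_\alpha=i}\bigl(\mathfrak t\setminus\operatorname{Ker}(\alpha)\bigr)\subset\mathfrak t$$ (an empty intersection being $\mathfrak t$).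
   Context: $Q$ is an (untwisted) irregular type written in the coordinate $x=z^{-1}$; $\mathbf B_Q$ is its universal space of admissible deformations of pole order at most $p$, identified with a subset of $\mathfrak t^p$ via $\sum_i A_i'x^i\mapsto(A_1',\dots,A_p')$. *)

theory Defs
  imports "HOL-Analysis.Analysis" "HOL-Computational_Algebra.Polynomial" "HOL-Library.FuncSet"
begin

text \<open>Finite-dimensional complex Lie algebras are modelled on the space complex ^ 'n
  (every finite-dimensional complex vector space is isomorphic to one of these),
  with scalar multiplication (*s) and a bracket br.\<close>

type_synonym 'n cvec = "complex ^ 'n"

definition lie_algebra :: "('n::finite cvec \<Rightarrow> 'n cvec \<Rightarrow> 'n cvec) \<Rightarrow> bool" where
  "lie_algebra br \<longleftrightarrow>
     (\<forall>x. Vector_Spaces.linear (*s) (*s) (br x)) \<and>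
     (\<forall>y. Vector_Spaces.linear (*s) (*s) (\<lambda>x. br x y)) \<and>
     (\<forall>x. br x x = 0) \<and>
     (\<forall>x y z. br x (br y z) + br y (br z x) + br z (br x y) = 0)"

definition lie_subalgebra :: "('n::finite cvec \<Rightarrow> 'n cvec \<Rightarrow> 'n cvec) \<Rightarrow> 'n cvec set \<Rightarrow> bool" where
  "lie_subalgebra br h \<longleftrightarrow> module.subspace (*s) h \<and> (\<forall>x\<in>h. \<forall>y\<in>h. br x y \<in> h)"

definition lie_ideal :: "('n::finite cvec \<Rightarrow> 'n cvec \<Rightarrow> 'n cvec) \<Rightarrow> 'n cvec set \<Rightarrow> bool" where
  "lie_ideal br I \<longleftrightarrow> module.subspace (*s) I \<and> (\<forall>x y. y \<in> I \<longrightarrow> br x y \<in> I)"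

text \<open>Reductive: the adjoint representation is completely reducible, i.e. every ideal
  has a complementary ideal.\<close>
definition reductive :: "('n::finite cvec \<Rightarrow> 'n cvec \<Rightarrow> 'n cvec) \<Rightarrow> bool" where
  "reductive br \<longleftrightarrow> lie_algebra br \<and>
     (\<forall>I. lie_ideal br I \<longrightarrow> (\<exists>J. lie_ideal br J \<and> I \<inter> J = {0} \<and>
            {x + y | x y. x \<in> I \<and> y \<in> J} = UNIV))"

text \<open>Nilpotent subalgebra: all iterated brackets [x1,[x2,...,[xn,y]]] of length n vanish.\<close>
definition nilpotent_subalgebra :: "('n::finite cvec \<Rightarrow> 'n cvec \<Rightarrow> 'n cvec) \<Rightarrow> 'n cvec set \<Rightarrow> bool" where
  "nilpotent_subalgebra br h \<longleftrightarrow> lie_subalgebra br h \<and>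
     (\<exists>n. \<forall>xs y. set xs \<subseteq> h \<and> length xs = n \<and> y \<in> h \<longrightarrow> foldr br xs y = 0)"

definition cartan_subalgebra :: "('n::finite cvec \<Rightarrow> 'n cvec \<Rightarrow> 'n cvec) \<Rightarrow> 'n cvec set \<Rightarrow> bool" where
  "cartan_subalgebra br t \<longleftrightarrow> nilpotent_subalgebra br t \<and>
     {x. \<forall>h\<in>t. br x h \<in> t} = t"

text \<open>Roots of (g,t): linear functionals (represented by complex-linear functionals on g,
  only their restriction to t matters) that are nonzero on t and whose generalized
  weight space is nonzero.\<close>
definition roots :: "('n::finite cvec \<Rightarrow> 'n cvec \<Rightarrow> 'n cvec) \<Rightarrow> 'n cvec set \<Rightarrow> ('n cvec \<Rightarrow> complex) set" where
  "roots br t = {\<alpha>. Vector_Spaces.linear (*s) (*) \<alpha> \<and> (\<exists>h\<in>t. \<alpha> h \<noteq> 0) \<and>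
     (\<exists>v. v \<noteq> 0 \<and> (\<forall>h\<in>t. \<exists>k. ((\<lambda>w. br h w - \<alpha> h *s w) ^^ k) v = 0))}"

text \<open>deg_x of sum_{i=1}^p alpha(A_i) x^i (degree of the zero polynomial is 0).\<close>
definition deg_alpha :: "('n::finite cvec \<Rightarrow> complex) \<Rightarrow> nat \<Rightarrow> (nat \<Rightarrow> 'n cvec) \<Rightarrow> nat" where
  "deg_alpha \<alpha> p A = degree (\<Sum>i=1..p. monom (\<alpha> (A i)) i)"

text \<open>B_Q as a subset of t^p; tuples are functions on {1..p} (extensional).\<close>
definition BQ :: "('n::finite cvec \<Rightarrow> 'n cvec \<Rightarrow> 'n cvec) \<Rightarrow> 'n cvec set \<Rightarrow> nat \<Rightarrow> (nat \<Rightarrow> 'n cvec) \<Rightarrow> (nat \<Rightarrow> 'n cvec) set" where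
  "BQ br t p A = {A' \<in> Pi\<^sub>E {1..p} (\<lambda>_. t).
      \<forall>\<alpha>\<in>roots br t. deg_alpha \<alpha> p A' = deg_alpha \<alpha> p A}"

definition Bi :: "('n::finite cvec \<Rightarrow> 'n cvec \<Rightarrow> 'n cvec) \<Rightarrow> 'n cvec set \<Rightarrow> nat \<Rightarrow> (nat \<Rightarrow> 'n cvec) \<Rightarrow> nat \<Rightarrow> 'n cvec set" where
  "Bi br t p A i = {h \<in> t.
      (\<forall>\<alpha>\<in>roots br t. deg_alpha \<alpha> p A < i \<longrightarrow> \<alpha> h = 0) \<and>
      (\<forall>\<alpha>\<in>roots br t. deg_alpha \<alpha> p A = i \<longrightarrow> \<alpha> h \<noteq> 0)}"

end

theory Submission
  imports Defs
begin

text \<open>A polynomial \<open>\<Sum>\<^sub>i \<alpha>(A'\<^sub>i) x\<^sup>i\<close> has degree \<open>d\<close> exactly when its coefficients above \<open>d\<close>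
  vanish and, for \<open>d \<ge> 1\<close>, its coefficient at \<open>d\<close> does not. Read index by index, the
  condition \<open>deg\<^sub>x(\<Sum>\<^sub>i \<alpha>(A'\<^sub>i) x\<^sup>i) = d\<^sub>\<alpha>\<close> therefore says \<open>\<alpha>(A'\<^sub>i) = 0\<close> for \<open>i > d\<^sub>\<alpha>\<close> and
  \<open>\<alpha>(A'\<^sub>i) \<noteq> 0\<close> for \<open>i = d\<^sub>\<alpha>\<close>, which is membership of \<open>A'\<^sub>i\<close> in \<open>B\<^sub>i\<close>.\<close>

lemma degree_eq_iff_coeff:
  fixes P :: "'a::zero poly"
  shows "degree P = d \<longleftrightarrow> (\<forall>i>d. coeff P i = 0) \<and> (d > 0 \<longrightarrow> coeff P d \<noteq> 0)"
proof
  assume deg: "degree P = d"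
  have "coeff P d \<noteq> 0" if "d > 0"
  proof -
    from that deg have "P \<noteq> 0" by auto
    with deg show ?thesis using leading_coeff_0_iff by metis
  qed
  with deg show "(\<forall>i>d. coeff P i = 0) \<and> (d > 0 \<longrightarrow> coeff P d \<noteq> 0)"
    by (simp add: coeff_eq_0)
next
  assume coeffs: "(\<forall>i>d. coeff P i = 0) \<and> (d > 0 \<longrightarrow> coeff P d \<noteq> 0)"
  then have "degree P \<le> d" by (simp add: degree_le)
  moreover have "d \<le> degree P"
    using coeffs le_degree by (cases "d = 0") auto
  ultimately show "degree P = d" by simp
qed

lemma coeff_sum_monom_atLeastAtMost:
  fixes c :: "nat \<Rightarrow> 'a::comm_monoid_add"
  shows "coeff (\<Sum>i=1..p. monom (c i) i) k = (if k \<in> {1..p} then c k else 0)"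
proof -
  have "coeff (\<Sum>i=1..p. monom (c i) i) k = (\<Sum>i=1..p. if i = k then c i else 0)"
    by (simp add: coeff_sum coeff_monom)
  also have "\<dots> = (if k \<in> {1..p} then c k else 0)"
    by (simp add: sum.delta)
  finally show ?thesis .
qed

lemma deg_alpha_le: "deg_alpha \<alpha> p A \<le> p"
  unfolding deg_alpha_def by (rule degree_le) (simp only: coeff_sum_monom_atLeastAtMost, simp)

lemma deg_alpha_eq_iff:
  "deg_alpha \<alpha> p A' = d \<longleftrightarrow>
    (\<forall>i\<in>{1..p}. (d < i \<longrightarrow> \<alpha> (A' i) = 0) \<and> (d = i \<longrightarrow> \<alpha> (A' i) \<noteq> 0))"
  if "d \<le> p"
  using that unfolding deg_alpha_def degree_eq_iff_coeff coeff_sum_monom_atLeastAtMost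
  by (auto simp: not_less_eq_eq)

theorem proposition2p6:
  fixes br :: "'n::finite cvec \<Rightarrow> 'n cvec \<Rightarrow> 'n cvec"
    and t :: "'n cvec set" and p :: nat and A :: "nat \<Rightarrow> 'n cvec"
  assumes "reductive br"
    and "cartan_subalgebra br t"
    and "p \<ge> 1"
    and "\<forall>i\<in>{1..p}. A i \<in> t"
  shows "BQ br t p A = Pi\<^sub>E {1..p} (Bi br t p A)"
proof (rule set_eqI)
  fix A'
  have "deg_alpha \<alpha> p A' = deg_alpha \<alpha> p A \<longleftrightarrow>
      (\<forall>i\<in>{1..p}. (deg_alpha \<alpha> p A < i \<longrightarrow> \<alpha> (A' i) = 0) \<and>
        (deg_alpha \<alpha> p A = i \<longrightarrow> \<alpha> (A' i) \<noteq> 0))" for \<alpha>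
    by (rule deg_alpha_eq_iff[OF deg_alpha_le])
  then show "A' \<in> BQ br t p A \<longleftrightarrow> A' \<in> Pi\<^sub>E {1..p} (Bi br t p A)"
    unfolding BQ_def Bi_def PiE_def Pi_def by auto
qed

end
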